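(* Let $p$ be a prime, $\alpha$ a positive integer and $\ell=p^{\alpha}$. Then there exists a positive integer $k$ such that the following holds for every $n$. Let $\mathcal{F}\subset \{0,1\}^{n}$ be $k$-closed over $\mathbb{Z}_{\ell}$. Then $\dim(\langle \mathcal{F}\rangle_{p})\leq \lfloor n/\ell\rfloor$.
   Context: Vectors in $\{0,1\}^n$ are regarded as elements of $\mathbb{Z}_\ell^n$ and of $\mathbb{F}_p^n$; $\langle\mathcal{F}\rangle_p$ denotes the span of $\mathcal{F}$ over $\mathbb{F}_p$. With $v\cdot w$ the coordinatewise product, $\mathcal{F}^i=\{v_1\cdot\ldots\cdot v_i: v_j\in\mathcal{F}\}$ (not necessarily distinct factors) and $\|v\|=\sum_j v(j)\in\mathbb{Z}_\ell$, $\mathcal{F}$ is $k$-closed over $\mathbb{Z}_\ell$ if $\|v\|=0$ for all $1\le i\le k$ and $v\in\mathcal{F}^i$ (equivalently, the intersection of any $k$ not necessarily distinct corresponding sets has size divisible by $\ell$). *)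

theory Defs
  imports Jordan_Normal_Form.DL_Rank Berlekamp_Zassenhaus.Finite_Field
begin

text \<open>The elements of \<open>{0,1}\<^sup>n\<close> are represented by vectors of natural numbers. The field with
  \<open>p\<close> elements is the type \<open>'p mod_ring\<close>, where \<open>'p\<close> is a type with a prime number
  \<open>p\<close> of elements.\<close>

definition zero_one_vecs :: "nat \<Rightarrow> nat vec set" where
  "zero_one_vecs n = {v \<in> carrier_vec n. \<forall>j<n. v $ j \<in> {0, 1}}"

text \<open>The family \<open>\<F>\<^sup>i\<close> of coordinatewise products of \<open>i\<close> not necessarily distinct members.
  The length \<open>n\<close> has to be given because the product of no vectors does not determine it.\<close>

definition product_family :: "nat \<Rightarrow> nat vec set \<Rightarrow> nat \<Rightarrow> nat vec set" where
  "product_family n F i = {vec n (\<lambda>j. \<Prod>m=1..i. v m $ j) | v. \<forall>m\<in>{1..i}. v m \<in> F}"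

text \<open>The element \<open>\<parallel>v\<parallel>\<close> of the ring of integers modulo \<open>l\<close>, as its representative in
  \<open>{0..<l}\<close> (for \<open>l > 0\<close>).\<close>

definition norm_mod :: "nat \<Rightarrow> nat vec \<Rightarrow> nat" where
  "norm_mod l v = (\<Sum>j<dim_vec v. v $ j) mod l"

definition k_closed :: "nat \<Rightarrow> nat \<Rightarrow> nat \<Rightarrow> nat vec set \<Rightarrow> bool" where
  "k_closed k l n F \<longleftrightarrow> (\<forall>i\<in>{1..k}. \<forall>v\<in>product_family n F i. norm_mod l v = 0)"

definition regard_mod :: "nat vec \<Rightarrow> 'p::prime_card mod_ring vec" where
  "regard_mod v = map_vec of_nat v"

definition (in vec_space) span_dim :: "'a vec set \<Rightarrow> nat" where
  "span_dim S = vectorspace.dim class_ring (span_vs S)"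

end

theory Submission
  imports Defs "HOL-Library.Function_Algebras"
begin

text \<open>Let \<open>W\<^sub>j\<close> be the span over the field with \<open>p\<close> elements of the indicator functions of
  the intersections of at most \<open>j\<close> members of the family. Suppose first that some nonempty set
  \<open>A\<close> that every member contains or avoids has its indicator function in \<open>W\<^sub>j\<close>, where \<open>j\<close>
  depends only on \<open>l\<close>. Lifting to the integers and taking \<open>l\<close>-th powers shows that \<open>l\<close>
  divides \<open>|A|\<close>; so deleting \<open>A\<close> keeps the family closed, costs at most one dimension and at
  least \<open>l\<close> points, and induction applies. If there is no such \<open>A\<close>, then
  \<open>2 dim W\<^sub>2\<^sub>j \<ge> 3 dim W\<^sub>j\<close> for all relevant \<open>j\<close>, and iterating this gives
  \<open>l dim W\<^sub>1 \<le> n\<close>. Since the field is finite, dimensions of function spaces are handled as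
  cardinalities.\<close>

section \<open>Counting in function spaces over a finite field\<close>

text \<open>With the pointwise addition of \<open>Function_Algebras\<close> this is the vector space
  of all functions on a type of points. Points can thus be deleted without a change of type.\<close>

definition fscale :: "'a::comm_ring_1 \<Rightarrow> ('i \<Rightarrow> 'a) \<Rightarrow> 'i \<Rightarrow> 'a" where
  "fscale c f = (\<lambda>x. c * f x)"

lemma fscale_apply: "fscale c f x = c * f x"
  by (simp add: fscale_def)

interpretation fmod: Modules.module fscale
  by unfold_locales (auto simp: fun_eq_iff fscale_apply algebra_simps)

definition res :: "'i set \<Rightarrow> ('i \<Rightarrow> 'a::zero) \<Rightarrow> 'i \<Rightarrow> 'a" where
  "res T f = (\<lambda>x. if x \<in> T then f x else 0)"

lemma res_apply: "res T f x = (if x \<in> T then f x else 0)"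
  by (simp add: res_def)

lemma card_functions_supported:
  assumes "finite T"
  shows "card {f :: 'i \<Rightarrow> 'a::{zero,finite}. \<forall>x. x \<notin> T \<longrightarrow> f x = 0} = CARD('a) ^ card T"
proof -
  have "bij_betw (\<lambda>f. restrict f T) {f :: 'i \<Rightarrow> 'a. \<forall>x. x \<notin> T \<longrightarrow> f x = 0} (T \<rightarrow>\<^sub>E UNIV)"
    by (rule bij_betw_byWitness[where f' = "res T"])
      (auto simp: fun_eq_iff res_apply PiE_def extensional_def)
  then show ?thesis
    using assms by (simp add: bij_betw_same_card card_PiE)
qed

lemma finite_functions_supported:
  assumes "finite T"
  shows "finite {f :: 'i \<Rightarrow> 'a::{zero,finite}. \<forall>x. x \<notin> T \<longrightarrow> f x = 0}"
  by (rule card_ge_0_finite) (simp add: card_functions_supported[OF assms])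

lemma finite_res_image [simp]:
  fixes V :: "('i \<Rightarrow> 'a::{zero,finite}) set"
  assumes "finite T"
  shows "finite (res T ` V)"
  by (rule finite_subset[OF _ finite_functions_supported[OF assms]]) (auto simp: res_apply)

lemma card_res_le:
  fixes V :: "('i \<Rightarrow> 'a::{zero,finite}) set"
  assumes "finite T"
  shows "card (res T ` V) \<le> CARD('a) ^ card T"
  unfolding card_functions_supported[OF assms, symmetric]
  by (rule card_mono[OF finite_functions_supported[OF assms]]) (auto simp: res_apply)

lemma card_res_full:
  assumes "finite T" and "\<And>f. \<exists>v\<in>V. \<forall>x\<in>T. v x = f x"
  shows "card (res T ` V :: ('i \<Rightarrow> 'a::{zero,finite}) set) = CARD('a) ^ card T"
proof -
  have "res T ` V = {f. \<forall>x. x \<notin> T \<longrightarrow> f x = 0}"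
  proof (intro equalityI subsetI)
    fix f :: "'i \<Rightarrow> 'a" assume f: "f \<in> {f. \<forall>x. x \<notin> T \<longrightarrow> f x = 0}"
    obtain v where "v \<in> V" "\<forall>x\<in>T. v x = f x" using assms(2) by blast
    moreover from this f have "f = res T v" by (auto simp: fun_eq_iff res_apply)
    ultimately show "f \<in> res T ` V" by blast
  qed (auto simp: res_apply)
  then show ?thesis by (simp add: card_functions_supported[OF assms(1)])
qed

section \<open>Rank-nullity and orthogonality by counting\<close>

text \<open>This is rank-nullity: the projection from \<open>T \<union> C\<close> to
  \<open>T\<close> has as kernel the functions of \<open>V\<close> vanishing on \<open>T\<close>,
  seen on \<open>C\<close>.\<close>

lemma card_res_Un:
  fixes V :: "('i \<Rightarrow> 'a::comm_ring_1) set"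
  assumes V: "fmod.subspace V" and disj: "T \<inter> C = {}"
  shows "card (res (T \<union> C) ` V)
    = card (res T ` V) * card (res C ` {v \<in> V. \<forall>x\<in>T. v x = 0})"
proof -
  let ?K = "res C ` {v \<in> V. \<forall>x\<in>T. v x = 0}"
  \<comment> \<open>An arbitrary lift of each projection to \<open>T\<close>; subtracting it from a
    function with that projection leaves an element of the kernel.\<close>
  define s where "s g = (SOME v. v \<in> V \<and> res T v = g)" for g
  have s: "s g \<in> V \<and> res T (s g) = g" if "g \<in> res T ` V" for g
  proof -
    have "\<exists>v. v \<in> V \<and> res T v = g" using that by auto
    then show ?thesis unfolding s_def by (rule someI_ex)
  qed
  have sV: "s (res T v) \<in> V" and sT: "x \<in> T \<Longrightarrow> s (res T v) x = v x" if "v \<in> V" for v x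
  proof -
    have "s (res T v) \<in> V \<and> res T (s (res T v)) = res T v" using s[of "res T v"] that by blast
    then show "s (res T v) \<in> V" "x \<in> T \<Longrightarrow> s (res T v) x = v x"
      by (auto simp: res_def fun_eq_iff split: if_splits)
  qed
  have "bij_betw (\<lambda>(g, k). res (T \<union> C) (s g) + k) (res T ` V \<times> ?K) (res (T \<union> C) ` V)"
    unfolding bij_betw_def
  proof (intro conjI inj_onI equalityI subsetI)
    fix a b
    assume a: "a \<in> res T ` V \<times> ?K" and b: "b \<in> res T ` V \<times> ?K"
      and eq: "(case a of (g, k) \<Rightarrow> res (T \<union> C) (s g) + k) = (case b of (g, k) \<Rightarrow> res (T \<union> C) (s g) + k)"
    obtain v k w l where ab: "a = (res T v, res C k)" "b = (res T w, res C l)"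
      and mem: "v \<in> V" "w \<in> V" and "\<forall>x\<in>T. k x = 0" "\<forall>x\<in>T. l x = 0"
      using a b by auto
    have eq': "res (T \<union> C) (s (res T v)) x + res C k x = res (T \<union> C) (s (res T w)) x + res C l x" for x
      using eq unfolding ab by (simp add: fun_eq_iff)
    have "v x = w x" if "x \<in> T" for x
      using eq'[of x] that disj sT[OF mem(1) that] sT[OF mem(2) that]
      by (auto simp: res_apply split: if_splits)
    then have 1: "res T v = res T w" by (auto simp: fun_eq_iff res_apply)
    moreover from this eq' have "res C k = res C l" by (intro ext) simp
    ultimately show "a = b" using ab by simp
  next
    fix f assume "f \<in> (\<lambda>(g, k). res (T \<union> C) (s g) + k) ` (res T ` V \<times> ?K)"
    then obtain v k where f: "f = res (T \<union> C) (s (res T v)) + res C k" and vk: "v \<in> V" "k \<in> V"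
      and k0: "\<forall>x\<in>T. k x = 0" by auto
    have "f = res (T \<union> C) (s (res T v) + k)"
      using k0 unfolding f by (auto simp: fun_eq_iff res_apply)
    moreover have "s (res T v) + k \<in> V" using sV vk V by (simp add: fmod.subspace_add)
    ultimately show "f \<in> res (T \<union> C) ` V" by blast
  next
    fix f assume "f \<in> res (T \<union> C) ` V"
    then obtain v where f: "f = res (T \<union> C) v" and v: "v \<in> V" by auto
    have "f = res (T \<union> C) (s (res T v)) + res C (v - s (res T v))"
      using sT[OF v] unfolding f by (auto simp: fun_eq_iff res_apply)
    moreover have "v - s (res T v) \<in> {v \<in> V. \<forall>x\<in>T. v x = 0}"
      using sV[OF v] sT[OF v] v V by (auto simp: fmod.subspace_diff)
    ultimately have "f = (\<lambda>(g, k). res (T \<union> C) (s g) + k) (res T v, res C (v - s (res T v)))"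
      and "(res T v, res C (v - s (res T v))) \<in> res T ` V \<times> ?K" using v by auto
    then show "f \<in> (\<lambda>(g, k). res (T \<union> C) (s g) + k) ` (res T ` V \<times> ?K)" by (rule image_eqI)
  qed
  then have "card (res T ` V \<times> ?K) = card (res (T \<union> C) ` V)" by (rule bij_betw_same_card)
  then show ?thesis by (simp add: card_cartesian_product)
qed

lemma subspace_vanishing:
  "fmod.subspace V \<Longrightarrow> fmod.subspace {v \<in> V. \<forall>x\<in>T. v x = 0}"
  by (auto simp: fmod.subspace_def fscale_apply)

text \<open>In dimensions: spaces orthogonal for a nondegenerate diagonal form on \<open>C\<close>
  have total dimension at most |C|. The induction splits off a point \<open>x\<close>, first for
  \<open>A\<close> and last for \<open>B\<close>: then \<open>A0\<close>, which vanishes at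
  \<open>x\<close>, remains orthogonal to \<open>B\<close> on \<open>C\<close>, and at
  \<open>x\<close> only one of \<open>A\<close> and \<open>B0\<close> can be nonzero.\<close>

lemma card_res_orthogonal:
  fixes A B :: "('i \<Rightarrow> 'a::{field,finite}) set"
  assumes "finite C" and "fmod.subspace A" "fmod.subspace B"
    and "\<And>x. x \<in> C \<Longrightarrow> w x \<noteq> 0"
    and "\<And>a b. a \<in> A \<Longrightarrow> b \<in> B \<Longrightarrow> (\<Sum>x\<in>C. w x * a x * b x) = 0"
  shows "card (res C ` A) * card (res C ` B) \<le> CARD('a) ^ card C"
  using assms
proof (induction C arbitrary: A B rule: finite_induct)
  case empty
  have "res {} ` V \<subseteq> {0}" for V :: "('i \<Rightarrow> 'a) set" by (auto simp: res_def fun_eq_iff)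
  then have "card (res {} ` V) \<le> 1" for V :: "('i \<Rightarrow> 'a) set"
    using card_mono[of "{0}" "res {} ` V"] by simp
  then show ?case using mult_le_mono[of _ 1 _ 1] by simp
next
  case (insert x C)
  have ins: "insert x C = C \<union> {x}" "insert x C = {x} \<union> C" "C \<inter> {x} = {}" "{x} \<inter> C = {}"
    using insert.hyps by auto
  define A0 where "A0 = {a \<in> A. \<forall>y\<in>{x}. a y = 0}"
  define B0 where "B0 = {b \<in> B. \<forall>y\<in>C. b y = 0}"
  have IH: "card (res C ` A0) * card (res C ` B) \<le> CARD('a) ^ card C"
  proof (rule insert.IH)
    show "fmod.subspace A0" unfolding A0_def by (rule subspace_vanishing) fact
    fix a b assume "a \<in> A0" "b \<in> B"
    then show "(\<Sum>y\<in>C. w y * a y * b y) = 0"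
      using insert.prems(4)[of a b] insert.hyps by (simp add: A0_def)
  qed (use insert.prems in auto)
  have cA: "card (res (insert x C) ` A) = card (res {x} ` A) * card (res C ` A0)"
    unfolding A0_def by (subst ins(2), rule card_res_Un) (use insert.prems insert.hyps in auto)
  have cB: "card (res (insert x C) ` B) = card (res C ` B) * card (res {x} ` B0)"
    unfolding B0_def by (subst ins(1), rule card_res_Un) (use insert.prems insert.hyps in auto)
  have "card (res {x} ` A) * card (res {x} ` B0) \<le> CARD('a)"
  proof (cases "\<forall>a\<in>A. a x = 0")
    case True
    then have "res {x} ` A \<subseteq> {0}" by (auto simp: res_def fun_eq_iff)
    then have "card (res {x} ` A) \<le> 1" using card_mono[of "{0}" "res {x} ` A"] by simp
    moreover have "card (res {x} ` B0) \<le> CARD('a)" using card_res_le[of "{x}" B0] by simp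
    ultimately show ?thesis using mult_le_mono[of _ 1] by fastforce
  next
    case False
    then obtain a where a: "a \<in> A" "a x \<noteq> 0" by auto
    \<comment> \<open>As \<open>b\<close> vanishes on \<open>C\<close>, only the term at
      \<open>x\<close> survives in the orthogonality relation.\<close>
    have "b x = 0" if "b \<in> B0" for b
      using insert.prems(4)[OF a(1), of b] that a insert.hyps insert.prems(3)[of x]
      by (simp add: B0_def)
    then have "res {x} ` B0 \<subseteq> {0}" by (auto simp: res_def fun_eq_iff)
    then have "card (res {x} ` B0) \<le> 1" using card_mono[of "{0}" "res {x} ` B0"] by simp
    moreover have "card (res {x} ` A) \<le> CARD('a)" using card_res_le[of "{x}" A] by simp
    ultimately show ?thesis using mult_le_mono[of _ _ _ 1] by fastforce
  qed
  then have "(card (res {x} ` A) * card (res {x} ` B0)) * (card (res C ` A0) * card (res C ` B))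
      \<le> CARD('a) * CARD('a) ^ card C"
    using IH by (rule mult_le_mono)
  then show ?case using insert.hyps by (simp add: cA cB ac_simps)
qed

section \<open>Growth of product spaces\<close>

lemma card_res_mono:
  fixes V :: "('i \<Rightarrow> 'a::{zero,finite}) set"
  assumes "finite C" "D \<subseteq> C"
  shows "card (res D ` V) \<le> card (res C ` V)"
proof -
  have "res D v = res D (res C v)" for v :: "'i \<Rightarrow> 'a"
    using assms(2) by (auto simp: fun_eq_iff res_apply)
  then have "res D ` V = res D ` (res C ` V)" by (auto simp: image_image)
  then show ?thesis using card_image_le[of "res C ` V" "res D"] assms(1) by simp
qed

lemma card_res_trivial:
  assumes "v0 \<in> V" "\<And>v x. v \<in> V \<Longrightarrow> x \<in> C \<Longrightarrow> v x = 0"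
  shows "card (res C ` V) = 1"
proof -
  have "res C v = 0" if "v \<in> V" for v using assms(2)[OF that] by (auto simp: fun_eq_iff res_apply)
  then have "res C ` V = {0}" using assms(1) by force
  then show ?thesis by simp
qed

lemma sum_fun_apply: "(\<Sum>i\<in>I. f i) x = (\<Sum>i\<in>I. f i x)"
  by (induction I rule: infinite_finite_induct) auto

text \<open>On \<open>C\<close> the space \<open>U\<close> is a hyperplane and \<open>w\<close> its
  normal vector. A zero weight would give a dependency on a proper subset, against
  \<open>full\<close>.\<close>

lemma ex_annihilating_weights:
  fixes U :: "('i \<Rightarrow> 'a::field) set"
  assumes U: "fmod.subspace U" and fin: "finite C" and C: "C \<noteq> {}"
    and full: "\<And>D f. D \<subset> C \<Longrightarrow> \<exists>u\<in>U. \<forall>x\<in>D. u x = f x"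
    and nfull: "\<not> (\<forall>f. \<exists>u\<in>U. \<forall>x\<in>C. u x = f x)"
  obtains w where "\<And>x. x \<in> C \<Longrightarrow> w x \<noteq> 0" "\<And>u. u \<in> U \<Longrightarrow> (\<Sum>x\<in>C. w x * u x) = 0"
proof -
  \<comment> \<open>Otherwise a multiple of \<open>u\<close> could correct the value at
    \<open>y\<close> alone, and \<open>U\<close> would attain all values on
    \<open>C\<close>.\<close>
  have van: "u y = 0" if u: "u \<in> U" and y: "y \<in> C" and z: "\<And>z. z \<in> C - {y} \<Longrightarrow> u z = 0" for u y
  proof (rule ccontr)
    assume uy: "u y \<noteq> 0"
    have "\<exists>v\<in>U. \<forall>x\<in>C. v x = f x" for f
    proof -
      have "C - {y} \<subset> C" using y by auto
      then obtain v where v: "v \<in> U" "\<forall>x\<in>C - {y}. v x = f x" using full by blast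
      let ?v = "v + fscale ((f y - v y) / u y) u"
      have "?v \<in> U" using u v U by (simp add: fmod.subspace_add fmod.subspace_scale)
      moreover have "?v x = f x" if "x \<in> C" for x
        using v(2) z[of x] uy that by (cases "x = y") (auto simp: fscale_apply)
      ultimately show ?thesis by blast
    qed
    then show False using nfull by blast
  qed
  obtain x0 where x0: "x0 \<in> C" using C by auto
  then have sub: "C - {x0} \<subset> C" by auto
  have "\<forall>y. \<exists>u. u \<in> U \<and> (\<forall>z\<in>C - {x0}. u z = (if z = y then 1 else 0))"
    using full[OF sub, of "\<lambda>z. if z = _ then 1 else 0"] by blast
  then obtain e where "\<forall>y. e y \<in> U \<and> (\<forall>z\<in>C - {x0}. e y z = (if z = y then 1 else 0))"
    by (rule choice[THEN exE])
  then have e: "\<And>y. e y \<in> U" "\<And>y z. z \<in> C - {x0} \<Longrightarrow> e y z = (if z = y then 1 else 0)"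
    by auto
  \<comment> \<open>The \<open>e y\<close> restrict to the unit functions on
    \<open>C - {x0}\<close>, so the dependency must say that \<open>u x0\<close> is the sum of the
    \<open>u y * e y x0\<close>.\<close>
  define w where "w x = (if x = x0 then 1 else - e x x0)" for x
  show thesis
  proof
    fix x assume x: "x \<in> C"
    show "w x \<noteq> 0"
    proof (cases "x = x0")
      case False
      have "e x x0 \<noteq> 0"
      proof
        assume "e x x0 = 0"
        then have "e x z = 0" if "z \<in> C - {x}" for z
          using that e(2)[of z x] by (cases "z = x0") auto
        then have "e x x = 0" using van[OF e(1) x] by blast
        then show False using e(2)[of x x] x False by simp
      qed
      then show ?thesis by (simp add: w_def False)
    qed (simp add: w_def)
  next
    fix u assume u: "u \<in> U"
    \<comment> \<open>The remainder vanishes on \<open>C - {x0}\<close> by construction, hence at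
      \<open>x0\<close> by \<open>van\<close>.\<close>
    let ?r = "u - (\<Sum>y\<in>C - {x0}. fscale (u y) (e y))"
    have r: "?r z = u z - (\<Sum>y\<in>C - {x0}. u y * e y z)" for z
      by (simp add: sum_fun_apply fscale_apply)
    have "?r z = 0" if "z \<in> C - {x0}" for z
    proof -
      have "(\<Sum>y\<in>C - {x0}. u y * e y z) = (\<Sum>y\<in>C - {x0}. if y = z then u y else 0)"
        using that by (intro sum.cong) (auto simp: e(2))
      also have "\<dots> = u z" using that fin by simp
      finally show ?thesis unfolding r by simp
    qed
    moreover have "?r \<in> U"
      using u e(1) U by (intro fmod.subspace_diff fmod.subspace_sum fmod.subspace_scale)
    ultimately have "?r x0 = 0" using van x0 by blast
    then have "u x0 = (\<Sum>y\<in>C - {x0}. u y * e y x0)" unfolding r by simp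
    moreover have "(\<Sum>x\<in>C. w x * u x) = w x0 * u x0 + (\<Sum>x\<in>C - {x0}. w x * u x)"
      using fin x0 by (simp add: sum.remove)
    moreover have "(\<Sum>x\<in>C - {x0}. w x * u x) = - (\<Sum>y\<in>C - {x0}. u y * e y x0)"
      unfolding sum_negf[symmetric] by (intro sum.cong) (auto simp: w_def)
    ultimately show "(\<Sum>x\<in>C. w x * u x) = 0" by (simp add: w_def)
  qed
qed

text \<open>In terms of dimensions the conclusion reads \<open>3 dim W \<le> 2 dim U\<close>. It is proved on larger
  and larger sets \<open>T\<close> of coordinates. If \<open>C\<close> is a minimal set outside \<open>T\<close> on which the
  functions of \<open>U\<close> vanishing on \<open>T\<close> are dependent, then the unique dependency makes the
  functions of \<open>W\<close> vanishing on \<open>T\<close> orthogonal to \<open>W\<close> on \<open>C\<close>; so the former contribute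
  at most \<open>min (|C| / 2) (|C| - 2)\<close> (or \<open>0\<close> if \<open>|C| = 1\<close>) to the dimension of \<open>W\<close>, while that of \<open>U\<close> grows by
  \<open>|C| - 1\<close>.\<close>

lemma card_product_space_growth:
  fixes W U :: "('i \<Rightarrow> 'a::{field,finite}) set"
  assumes fin: "finite X" and W: "fmod.subspace W" and U: "fmod.subspace U" and "W \<subseteq> U"
    and prod: "\<And>f g. f \<in> W \<Longrightarrow> g \<in> W \<Longrightarrow> f * g \<in> U"
    and pairs: "\<And>x y a b. x \<in> X \<Longrightarrow> y \<in> X \<Longrightarrow> x \<noteq> y \<Longrightarrow> \<exists>f\<in>W. f x = a \<and> f y = b"
    and no_delta: "\<And>x u. x \<in> X \<Longrightarrow> u \<in> U \<Longrightarrow> \<forall>y\<in>X - {x}. u y = 0 \<Longrightarrow> u x = 0"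
  shows "card (res X ` W) ^ 3 \<le> card (res X ` U) ^ 2"
proof -
  let ?q = "CARD('a)"
  let ?P = "\<lambda>T. card (res T ` W) ^ 3 \<le> card (res T ` U) ^ 2"
  have 0: "0 \<in> W" "0 \<in> U" using W U by (simp_all add: fmod.subspace_0)
  have "{} \<in> {T \<in> Pow X. ?P T}"
    using card_res_trivial[of 0 W "{}"] card_res_trivial[of 0 U "{}"] 0 by simp
  then obtain T where T: "T \<subseteq> X" "?P T" and max: "\<And>S. S \<subseteq> X \<Longrightarrow> ?P S \<Longrightarrow> T \<subseteq> S \<Longrightarrow> T = S"
  proof -
    have "finite {T \<in> Pow X. ?P T}" using fin by simp
    from finite_has_maximal[OF this] \<open>{} \<in> {T \<in> Pow X. ?P T}\<close> obtain T
      where "T \<in> {T \<in> Pow X. ?P T}" "\<forall>S\<in>{T \<in> Pow X. ?P T}. T \<subseteq> S \<longrightarrow> T = S" by blast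
    then show thesis by (intro that[of T]) blast+
  qed
  have "T = X"
  proof (rule ccontr)
    assume "T \<noteq> X"
    then obtain x1 where x1: "x1 \<in> X - T" using T by auto
    define U0 where "U0 = {u \<in> U. \<forall>x\<in>T. u x = 0}"
    define W0 where "W0 = {u \<in> W. \<forall>x\<in>T. u x = 0}"
    have U0: "fmod.subspace U0" "U0 \<subseteq> U" and W0: "fmod.subspace W0" "W0 \<subseteq> W" "W0 \<subseteq> U0"
      using U W \<open>W \<subseteq> U\<close> by (auto simp: U0_def W0_def intro: subspace_vanishing)
    have 00: "0 \<in> U0" "0 \<in> W0" using U0 W0 by (simp_all add: fmod.subspace_0)
    let ?full = "\<lambda>C. \<forall>f. \<exists>u\<in>U0. \<forall>x\<in>C. u x = f x"
    \<comment> \<open>A function in \<open>U0\<close> that is 1 at \<open>x1\<close> and 0 elsewhere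
      on \<open>X - T\<close> vanishes on \<open>X - {x1}\<close>, which \<open>no_delta\<close>
      excludes.\<close>
    have "\<not> ?full (X - T)"
    proof
      assume "?full (X - T)"
      then have "\<exists>u\<in>U0. \<forall>x\<in>X - T. u x = (if x = x1 then 1 else 0)" by (rule spec)
      then obtain u where u: "u \<in> U0" "\<forall>x\<in>X - T. u x = (if x = x1 then 1 else 0)" by blast
      have "u y = 0" if "y \<in> X - {x1}" for y
        using u that by (cases "y \<in> T") (auto simp: U0_def)
      then have "\<forall>y\<in>X - {x1}. u y = 0" by blast
      then have "u x1 = 0" using no_delta[of x1 u] u x1 U0 by auto
      then show False using u x1 by auto
    qed
    then have "X - T \<in> {C \<in> Pow (X - T). \<not> ?full C}" by blast
    then obtain C where C: "C \<subseteq> X - T" "\<not> ?full C" and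
      min: "\<And>D. D \<subseteq> X - T \<Longrightarrow> \<not> ?full D \<Longrightarrow> D \<subseteq> C \<Longrightarrow> C = D"
    proof -
      have "finite {C \<in> Pow (X - T). \<not> ?full C}" using fin by simp
      from finite_has_minimal[OF this] \<open>X - T \<in> {C \<in> Pow (X - T). \<not> ?full C}\<close> obtain C
        where "C \<in> {C \<in> Pow (X - T). \<not> ?full C}"
          "\<forall>D\<in>{C \<in> Pow (X - T). \<not> ?full C}. D \<subseteq> C \<longrightarrow> C = D" by blast
      then show thesis by (intro that[of C]) blast+
    qed
    have fullD: "\<exists>u\<in>U0. \<forall>x\<in>D. u x = f x" if "D \<subset> C" for D f
      using min[of D] that C(1) by blast
    have finC: "finite C" using C fin finite_subset by blast
    have Cne: "C \<noteq> {}" using C(2) 00 by auto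
    then obtain x0 where x0: "x0 \<in> C" by auto
    define c where "c = card C"
    define w where "w = card (res C ` W0)"
    define b where "b = card (res C ` W)"
    have cU: "?q ^ (c - 1) \<le> card (res C ` U0)"
    proof -
      have "C - {x0} \<subset> C" using x0 by auto
      then have "card (res (C - {x0}) ` U0) = ?q ^ card (C - {x0})"
        using fullD finC by (intro card_res_full) auto
      then have "?q ^ (c - 1) = card (res (C - {x0}) ` U0)" using x0 by (simp add: c_def)
      also have "\<dots> \<le> card (res C ` U0)" using finC by (rule card_res_mono) auto
      finally show ?thesis .
    qed
    obtain wt where wt: "\<And>x. x \<in> C \<Longrightarrow> wt x \<noteq> 0" "\<And>u. u \<in> U0 \<Longrightarrow> (\<Sum>x\<in>C. wt x * u x) = 0"
      using ex_annihilating_weights[OF U0(1) finC Cne fullD C(2)] by blast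
    have wb: "w * b \<le> ?q ^ c"
      unfolding w_def b_def c_def
    proof (rule card_res_orthogonal[OF finC W0(1) W wt(1)])
      fix f g assume fg: "f \<in> W0" "g \<in> W"
      \<comment> \<open>The product inherits the zeros of \<open>f\<close> on \<open>T\<close>, so
        the dependency of \<open>U0\<close> applies to it and becomes the orthogonality of
        \<open>f\<close> and \<open>g\<close>.\<close>
      then have "f * g \<in> U0" using prod W0 by (auto simp: U0_def W0_def)
      then show "(\<Sum>x\<in>C. wt x * f x * g x) = 0" using wt(2)[of "f * g"] by (simp add: mult.assoc)
    qed
    have "w \<le> b" unfolding w_def b_def using W0 finC by (intro card_mono) auto
    have "w ^ 3 \<le> card (res C ` U0) ^ 2"
    proof (cases "C = {x0}")
      case True
      then have "(\<Sum>x\<in>C. wt x * u x) = wt x0 * u x0" for u by simp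
      then have "u x = 0" if "u \<in> W0" "x \<in> C" for u x
        using wt(1)[of x0] wt(2)[of u] that True W0 by auto
      then have "w = 1" unfolding w_def using 00 by (intro card_res_trivial)
      moreover have "card (res C ` U0) > 0" using 00 finC by (auto simp: card_gt_0_iff)
      ultimately show ?thesis by simp
    next
      case False
      then obtain y0 where y0: "y0 \<in> C" "y0 \<noteq> x0" using x0 by auto
      have "c \<ge> 2" using card_mono[of C "{x0, y0}"] x0 y0 finC by (simp add: c_def)
      have "card (res {x0, y0} ` W) = ?q ^ card {x0, y0}"
      proof (rule card_res_full)
        fix f show "\<exists>v\<in>W. \<forall>x\<in>{x0, y0}. v x = f x"
          using pairs[of x0 y0 "f x0" "f y0"] x0 y0 C(1) by auto
      qed simp
      moreover have "card (res {x0, y0} ` W) \<le> b"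
        unfolding b_def using x0 y0 finC by (intro card_res_mono) auto
      \<comment> \<open>Two points of \<open>C\<close> can be prescribed independently, so
        \<open>W\<close> has dimension at least 2 on \<open>C\<close>; this is the source of the
        exponent \<open>c - 2\<close>.\<close>
      ultimately have qb: "?q ^ 2 \<le> b" using y0 by (simp add: power2_eq_square)
      have "?q ^ c = ?q ^ (c - 2) * ?q ^ 2" using \<open>c \<ge> 2\<close> by (metis le_add_diff_inverse2 power_add)
      then have "w * ?q ^ 2 \<le> ?q ^ (c - 2) * ?q ^ 2"
        using mult_le_mono2[OF qb, of w] wb by linarith
      then have 1: "w \<le> ?q ^ (c - 2)" by simp
      have 2: "w ^ 2 \<le> ?q ^ c"
        unfolding power2_eq_square using mult_le_mono2[OF \<open>w \<le> b\<close>, of w] wb by linarith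
      \<comment> \<open>The bounds c/2 and c - 2 on the dimension are combined with weights 2 and 1,
        giving exactly 2(c - 1).\<close>
      have "w ^ 3 = w ^ 2 * w" by (simp add: numeral_eq_Suc)
      also have "\<dots> \<le> ?q ^ c * ?q ^ (c - 2)" using 1 2 by (rule mult_le_mono[rotated])
      also have "\<dots> = (?q ^ (c - 1)) ^ 2"
        using \<open>c \<ge> 2\<close> by (auto simp flip: power_add power_mult intro!: arg_cong[of _ _ "\<lambda>n. ?q ^ n"])
      also have "\<dots> \<le> card (res C ` U0) ^ 2" using cU by (rule power_mono) simp
      finally show ?thesis .
    qed
    then have "card (res T ` W) ^ 3 * w ^ 3 \<le> card (res T ` U) ^ 2 * card (res C ` U0) ^ 2"
      using T(2) by (intro mult_le_mono)
    moreover have "T \<inter> C = {}" using C by auto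
    ultimately have "?P (T \<union> C)"
      using card_res_Un[OF W \<open>T \<inter> C = {}\<close>] card_res_Un[OF U \<open>T \<inter> C = {}\<close>]
      by (simp add: w_def W0_def U0_def power_mult_distrib)
    then have "T = T \<union> C" using max[of "T \<union> C"] T C by auto
    then show False using Cne C by auto
  qed
  then show ?thesis using T by simp
qed

section \<open>Intersections and lifting to the integers\<close>

text \<open>Polymorphic in the ring, so that the same sets generate a space over the field and a
  module of integer functions.\<close>

definition ind :: "'i set \<Rightarrow> 'i \<Rightarrow> 'a::comm_ring_1" where
  "ind B x = of_bool (x \<in> B)"

text \<open>Subfamilies replace sequences since repeated members do not change an intersection. The
  empty subfamily is excluded because its intersection would be the whole type.\<close>

definition meets :: "nat \<Rightarrow> 'i set set \<Rightarrow> 'i set set" where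
  "meets k \<F> = {\<Inter>\<G> | \<G>. \<G> \<subseteq> \<F> \<and> \<G> \<noteq> {} \<and> finite \<G> \<and> card \<G> \<le> k}"

lemma ind_mult: "ind B * ind C = ind (B \<inter> C)"
  by (auto simp: ind_def fun_eq_iff)

lemma meets_mono: "i \<le> j \<Longrightarrow> meets i \<F> \<subseteq> meets j \<F>"
  unfolding meets_def by (blast intro: le_trans)

lemma meets_single: "B \<in> \<F> \<Longrightarrow> k > 0 \<Longrightarrow> B \<in> meets k \<F>"
  unfolding meets_def by (intro CollectI exI[of _ "{B}"]) auto

lemma meets_Int:
  assumes "B \<in> meets i \<F>" "C \<in> meets j \<F>"
  shows "B \<inter> C \<in> meets (i + j) \<F>"
proof -
  obtain \<G> \<H> where "B = \<Inter>\<G>" "\<G> \<subseteq> \<F>" "\<G> \<noteq> {}" "finite \<G>" "card \<G> \<le> i"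
    and "C = \<Inter>\<H>" "\<H> \<subseteq> \<F>" "finite \<H>" "card \<H> \<le> j"
    using assms by (auto simp: meets_def)
  then show ?thesis
    using card_Un_le[of \<G> \<H>] unfolding meets_def
    by (intro CollectI exI[of _ "\<G> \<union> \<H>"]) auto
qed

lemma meets_subset: "B \<in> meets k \<F> \<Longrightarrow> \<F> \<subseteq> Pow N \<Longrightarrow> B \<subseteq> N"
  by (fastforce simp: meets_def)

lemma span_mult_closed:
  assumes "\<And>s t. s \<in> S \<Longrightarrow> t \<in> T \<Longrightarrow> s * t \<in> fmod.span R"
    and "f \<in> fmod.span S" "g \<in> fmod.span T"
  shows "f * g \<in> fmod.span R"
  using assms(2)
proof (induction rule: fmod.span_induct_alt)
  case base
  have "0 * g = 0" by simp
  then show ?case by (metis fmod.span_zero)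
next
  case (step c s y)
  have "s * g \<in> fmod.span R"
    using assms(3)
  proof (induction rule: fmod.span_induct_alt)
    case base
    have "s * 0 = 0" by simp
    then show ?case by (metis fmod.span_zero)
  next
    case (step d t z)
    have "s * (fscale d t + z) = fscale d (s * t) + s * z"
      by (auto simp: fun_eq_iff fscale_apply algebra_simps)
    then show ?case
      using assms(1)[OF \<open>s \<in> S\<close> step(1)] step(2) by (metis fmod.span_add fmod.span_scale)
  qed
  moreover have "(fscale c s + y) * g = fscale c (s * g) + y * g"
    by (auto simp: fun_eq_iff fscale_apply algebra_simps)
  ultimately show ?case using step(2) by (metis fmod.span_add fmod.span_scale)
qed

lemma span_meets_mult:
  assumes "f \<in> fmod.span (ind ` meets i \<F>)" "g \<in> fmod.span (ind ` meets j \<F>)"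
  shows "f * g \<in> fmod.span (ind ` meets (i + j) \<F>)"
  using _ assms by (rule span_mult_closed)
    (auto simp: ind_mult intro!: fmod.span_base imageI meets_Int)

lemma span_meets_power:
  assumes "f \<in> fmod.span (ind ` meets j \<F>)" "m > 0"
  shows "(\<lambda>x. f x ^ m) \<in> fmod.span (ind ` meets (m * j) \<F>)"
  using assms(2)
proof (induction m rule: nat_induct_non_zero)
  case 1
  then show ?case using assms(1) by simp
next
  case (Suc m)
  have "(\<lambda>x. f x ^ Suc m) = f * (\<lambda>x. f x ^ m)" by (simp add: fun_eq_iff)
  then show ?case using span_meets_mult[OF assms(1) Suc.IH] by simp
qed

section \<open>Divisibility of cardinalities via integer lifts\<close>

lemma dvd_sum_span_ind:
  fixes h :: "'i \<Rightarrow> int"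
  assumes "finite N" and "\<And>B. B \<in> S \<Longrightarrow> B \<subseteq> N" "\<And>B. B \<in> S \<Longrightarrow> l dvd card B"
    and "h \<in> fmod.span (ind ` S)"
  shows "int l dvd (\<Sum>x\<in>N. h x)"
  using assms(4)
proof (induction rule: fmod.span_induct_alt)
  case (step c s y)
  then obtain B where s: "s = ind B" "B \<in> S" by auto
  have "(\<Sum>x\<in>N. s x) = int (card B)"
    using assms(1) assms(2)[OF s(2)] by (simp add: s(1) ind_def of_bool_def sum.If_cases Int_absorb1)
  then have "int l dvd (\<Sum>x\<in>N. s x)" using assms(3)[OF s(2)] by simp
  then show ?case
    using step by (simp add: fscale_apply sum.distrib dvd_add flip: sum_distrib_left)
qed simp

text \<open>Each coefficient of a linear combination is replaced by its integer representative,
  while the indicators stay.\<close>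

lemma span_ind_lift:
  fixes g :: "'i \<Rightarrow> 'p::prime_card mod_ring"
  assumes "g \<in> fmod.span (ind ` S)"
  obtains h :: "'i \<Rightarrow> int" where "h \<in> fmod.span (ind ` S)" "\<And>x. of_int (h x) = g x"
proof -
  have "\<exists>h \<in> fmod.span (ind ` S). \<forall>x. of_int (h x :: int) = g x"
    using assms
  proof (induction rule: fmod.span_induct_alt)
    case base
    show ?case by (rule bexI[of _ 0]) (auto simp: fmod.span_zero)
  next
    case (step c s y)
    then obtain B h where s: "s = ind B" "B \<in> S"
      and h: "h \<in> fmod.span (ind ` S)" "\<And>x. of_int (h x :: int) = y x" by auto
    define h' where "h' = fscale (to_int_mod_ring c) (ind B) + h"
    have "h' \<in> fmod.span (ind ` S)"
      unfolding h'_def using h(1) s(2) by (intro fmod.span_add fmod.span_scale) (auto intro: fmod.span_base)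
    moreover have "(of_int (to_int_mod_ring c) :: 'p mod_ring) = c"
      by (simp add: of_int_of_int_mod_ring)
    then have "of_int (h' x) = (fscale c s + y) x" for x
      using h by (simp add: h'_def fscale_apply s ind_def)
    ultimately show ?case by blast
  qed
  then show ?thesis using that by blast
qed

text \<open>Each p-th power gains a factor p: in
  \<open>g ^ p - 1 = (g - 1) * (\<Sum>i<p. g ^ i)\<close> the sum has p terms congruent to 1 modulo
  p.\<close>

lemma power_prime_power_cong_1:
  fixes h :: int
  assumes "int p dvd h - 1"
  shows "int p ^ (a + 1) dvd h ^ (p ^ a) - 1"
proof (induction a)
  case 0
  then show ?case using assms by simp
next
  case (Suc a)
  define g where "g = h ^ (p ^ a)"
  have "int p dvd g - 1"
    using Suc.IH unfolding g_def by (rule dvd_trans[rotated]) simp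
  have "[(\<Sum>i<p. g ^ i) = (\<Sum>i<p. 1)] (mod int p)"
  proof (rule cong_sum)
    fix i
    have "[g = 1] (mod int p)" using \<open>int p dvd g - 1\<close> by (simp add: cong_iff_dvd_diff)
    then have "[g ^ i = 1 ^ i] (mod int p)" by (rule cong_pow)
    then show "[g ^ i = 1] (mod int p)" by simp
  qed
  then have "int p dvd (\<Sum>i<p. g ^ i)" by (simp add: cong_iff_dvd_diff dvd_diff_left_iff)
  then have "int p ^ (a + 1) * int p dvd (g - 1) * (\<Sum>i<p. g ^ i)"
    using Suc.IH unfolding g_def by (intro mult_dvd_mono)
  also have "(g - 1) * (\<Sum>i<p. g ^ i) = g ^ p - 1" by (rule power_diff_1_eq[symmetric])
  also have "g ^ p = h ^ (p ^ Suc a)" by (simp add: g_def flip: power_mult) (simp add: mult.commute)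
  finally show ?case by (simp add: mult.commute)
qed

lemma of_int_mod_ring_eq_0_iff:
  "(of_int z :: 'p::prime_card mod_ring) = 0 \<longleftrightarrow> int (CARD('p)) dvd z"
  by (metis of_int_eq_0_iff_char_dvd semiring_char_mod_ring)

text \<open>A function that is \<open>0\<close> or \<open>1\<close> modulo \<open>p\<close> becomes an indicator function modulo
  \<open>p\<^sup>\<alpha>\<close> after raising it to a high power of \<open>p\<close>.\<close>

lemma dvd_card_of_ind_in_span:
  assumes "finite N" "\<F> \<subseteq> Pow N" "A \<subseteq> N" and l: "l = CARD('p::prime_card) ^ \<alpha>"
    and dvd: "\<And>B. B \<in> meets (l * j) \<F> \<Longrightarrow> l dvd card B"
    and A: "(ind A :: 'i \<Rightarrow> 'p mod_ring) \<in> fmod.span (ind ` meets j \<F>)"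
  shows "l dvd card A"
proof -
  let ?p = "CARD('p)"
  obtain h :: "'i \<Rightarrow> int" where h: "h \<in> fmod.span (ind ` meets j \<F>)"
    and of_h: "\<And>x. (of_int (h x) :: 'p mod_ring) = ind A x"
    using span_ind_lift[OF A] by blast
  have "l > 0" by (simp add: l)
  \<comment> \<open>The \<open>l\<close>-th power of \<open>h\<close> is an integer combination of
    indicators of intersections of at most \<open>l * j\<close> members, each of size divisible by
    \<open>l\<close>.\<close>
  have "int l dvd (\<Sum>x\<in>N. h x ^ l)"
    using assms(1) _ dvd span_meets_power[OF h \<open>l > 0\<close>]
    by (rule dvd_sum_span_ind) (rule meets_subset[OF _ assms(2)])
  moreover have "int l dvd h x ^ l - ind A x" for x
  proof (cases "x \<in> A")
    case True
    then have "int ?p dvd h x - 1"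
      using of_h[of x] by (simp flip: of_int_mod_ring_eq_0_iff add: ind_def)
    from power_prime_power_cong_1[OF this, of \<alpha>] show ?thesis
      using True by (auto simp: l ind_def intro: dvd_trans[rotated])
  next
    case False
    then have "int ?p dvd h x"
      using of_h[of x] by (simp flip: of_int_mod_ring_eq_0_iff add: ind_def)
    then have "int ?p ^ l dvd h x ^ l" by (rule dvd_power_same)
    \<comment> \<open>Off \<open>A\<close> the exponent \<open>l\<close> is large enough for
      \<open>l = p ^ \<alpha>\<close> to divide \<open>p ^ l\<close>.\<close>
    moreover have "\<alpha> < l" unfolding l using prime_gt_1_nat[OF prime_card, where 'a1 = 'p]
      by (intro power_gt_expt) auto
    then have "int l dvd int ?p ^ l" by (simp add: l le_imp_power_dvd)
    ultimately show ?thesis using False by (auto simp: ind_def intro: dvd_trans)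
  qed
  then have "int l dvd (\<Sum>x\<in>N. h x ^ l - ind A x)" by (intro dvd_sum)
  ultimately have "int l dvd (\<Sum>x\<in>N. ind A x)" by (simp add: sum_subtractf dvd_diff_right_iff)
  moreover have "(\<Sum>x\<in>N. ind A x) = int (card A)"
    using assms(1,3) by (simp add: ind_def of_bool_def sum.If_cases Int_absorb1)
  ultimately show ?thesis by simp
qed

section \<open>Closed families\<close>

lemma span_ind_const:
  assumes "f \<in> fmod.span (ind ` S)" and "\<And>B. B \<in> S \<Longrightarrow> x \<in> B \<longleftrightarrow> y \<in> B"
  shows "f x = f y"
  using assms(1)
  by (induction rule: fmod.span_induct_alt) (auto simp: fscale_apply ind_def assms(2))

lemma span_ind_zero:
  assumes "f \<in> fmod.span (ind ` S)" and "\<And>B. B \<in> S \<Longrightarrow> x \<notin> B"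
  shows "f x = 0"
  using assms(1)
  by (induction rule: fmod.span_induct_alt) (auto simp: fscale_apply ind_def assms(2))

lemma mem_meets_iff:
  assumes "B \<in> meets k \<F>" "{C \<in> \<F>. x \<in> C} = {C \<in> \<F>. y \<in> C}"
  shows "x \<in> B \<longleftrightarrow> y \<in> B"
  using assms by (auto simp: meets_def)

lemma finite_span_ind:
  fixes S :: "'i set set"
  assumes "finite N" "S \<subseteq> Pow N"
  shows "finite (fmod.span (ind ` S) :: ('i \<Rightarrow> 'a::{comm_ring_1,finite}) set)"
proof (rule finite_subset[OF _ finite_functions_supported[OF assms(1)]], safe)
  fix f :: "'i \<Rightarrow> 'a" and x assume "f \<in> fmod.span (ind ` S)" "x \<notin> N"
  then show "f x = 0" using assms(2) by (intro span_ind_zero) auto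
qed

section \<open>Deleting a set that no member cuts\<close>

lemma meets_Diff:
  assumes "B \<in> meets k ((\<lambda>B. B - A) ` \<F>)"
  obtains C where "C \<in> meets k \<F>" "B = C - A"
proof -
  obtain \<G> where \<G>: "B = \<Inter>\<G>" "\<G> \<subseteq> (\<lambda>B. B - A) ` \<F>" "\<G> \<noteq> {}" "finite \<G>" "card \<G> \<le> k"
    using assms by (auto simp: meets_def)
  from \<G>(2) obtain \<H> where \<H>: "\<H> \<subseteq> \<F>" "inj_on (\<lambda>B. B - A) \<H>" "\<G> = (\<lambda>B. B - A) ` \<H>"
    by (auto simp: subset_image_inj)
  \<comment> \<open>One preimage was chosen for each trace, so \<open>\<H>\<close> has no more
    members than \<open>\<G>\<close>.\<close>
  have "\<Inter>\<H> \<in> meets k \<F>"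
    unfolding meets_def using \<G> \<H> by (intro CollectI exI[of _ \<H>]) (auto simp: card_image finite_image_iff)
  moreover have "B = \<Inter>\<H> - A" using \<G> \<H> by auto
  ultimately show ?thesis by (rule that)
qed

text \<open>Rank-nullity for the projection to \<open>N - A\<close>: its image lies in the span of
  the traces, and its kernel has dimension at most 1, since functions in the span are constant on
  \<open>A\<close>.\<close>

lemma card_span_ind_remove:
  fixes \<F> :: "'i set set"
  assumes N: "finite N" "\<F> \<subseteq> Pow N" and A: "A \<subseteq> N" "A \<noteq> {}"
    and atom: "\<And>B. B \<in> \<F> \<Longrightarrow> A \<subseteq> B \<or> A \<inter> B = {}"
  shows "card (fmod.span (ind ` \<F>) :: ('i \<Rightarrow> 'a::{comm_ring_1,finite}) set)
    \<le> card (fmod.span (ind ` (\<lambda>B. B - A) ` \<F>) :: ('i \<Rightarrow> 'a) set) * CARD('a)"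
proof -
  let ?V = "fmod.span (ind ` \<F>) :: ('i \<Rightarrow> 'a) set"
  let ?V' = "fmod.span (ind ` (\<lambda>B. B - A) ` \<F>) :: ('i \<Rightarrow> 'a) set"
  have res_N: "res N f = f" if "f \<in> ?V" for f
  proof
    fix x show "res N f x = f x"
      using span_ind_zero[OF that, of x] N by (auto simp: res_apply)
  qed
  then have "?V = res N ` ?V" by force
  also have "\<dots> = res ((N - A) \<union> A) ` ?V" using A by (simp add: Un_absorb2)
  finally have "card ?V = card (res ((N - A) \<union> A) ` ?V)" by (rule arg_cong)
  also have "\<dots> = card (res (N - A) ` ?V) * card (res A ` {v \<in> ?V. \<forall>x\<in>N - A. v x = 0})"
    by (rule card_res_Un) (auto intro: fmod.subspace_span)
  also have "\<dots> \<le> card ?V' * CARD('a)"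
  proof (rule mult_le_mono)
    have "res (N - A) f \<in> ?V'" if "f \<in> ?V" for f
      using that
    proof (induction rule: fmod.span_induct_alt)
      case base
      have "res (N - A) (0 :: 'i \<Rightarrow> 'a) = 0" by (auto simp: fun_eq_iff res_apply)
      then show ?case by (metis fmod.span_zero)
    next
      case (step c s y)
      then obtain B where B: "s = ind B" "B \<in> \<F>" by auto
      have "res (N - A) (fscale c s + y) = fscale c (ind (B - A)) + res (N - A) y"
        using B N(2) by (auto simp: fun_eq_iff res_apply fscale_apply ind_def)
      moreover have "ind (B - A) \<in> ?V'" using B(2) by (intro fmod.span_base) auto
      ultimately show ?case using step(2) by (metis fmod.span_add fmod.span_scale)
    qed
    moreover have "finite ?V'" by (rule finite_span_ind[OF N(1)]) (use N(2) in auto)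
    ultimately show "card (res (N - A) ` ?V) \<le> card ?V'" by (intro card_mono) auto
  next
    obtain a where a: "a \<in> A" using A(2) by auto
    have "res A v = (\<lambda>x. if x \<in> A then v a else 0)" if "v \<in> ?V" for v
    proof
      fix x
      have "v x = v a" if "x \<in> A"
        using \<open>v \<in> ?V\<close> by (rule span_ind_const) (use that a atom in blast)
      then show "res A v x = (if x \<in> A then v a else 0)" by (simp add: res_apply)
    qed
    then have "res A ` {v \<in> ?V. \<forall>x\<in>N - A. v x = 0} \<subseteq> (\<lambda>c x. if x \<in> A then c else 0) ` UNIV"
      by auto
    then have "card (res A ` {v \<in> ?V. \<forall>x\<in>N - A. v x = 0})
        \<le> card ((\<lambda>c x. if x \<in> A then c else 0) ` (UNIV :: 'a set))"
      by (intro card_mono) auto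
    also have "\<dots> \<le> CARD('a)" by (rule card_image_le) simp
    finally show "card (res A ` {v \<in> ?V. \<forall>x\<in>N - A. v x = 0}) \<le> CARD('a)" .
  qed
  finally show ?thesis .
qed

section \<open>Iterated growth\<close>

text \<open>In logarithms, each step multiplies by at least 3/2; integer powers avoid
  fractions.\<close>

lemma power_3_2_iterate:
  fixes D :: "nat \<Rightarrow> nat"
  assumes "\<And>t. t < s \<Longrightarrow> D t ^ 3 \<le> D (Suc t) ^ 2"
  shows "D 0 ^ (3 ^ s) \<le> D s ^ (2 ^ s)"
  using assms
proof (induction s)
  case (Suc s)
  have "D 0 ^ 3 ^ Suc s = (D 0 ^ 3 ^ s) ^ 3" by (simp add: mult.commute flip: power_mult)
  also have "\<dots> \<le> (D s ^ 2 ^ s) ^ 3" using Suc by (intro power_mono) auto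
  also have "\<dots> = (D s ^ 3) ^ 2 ^ s" by (simp add: mult.commute flip: power_mult)
  also have "\<dots> \<le> (D (Suc s) ^ 2) ^ 2 ^ s" using Suc.prems by (intro power_mono) auto
  also have "\<dots> = D (Suc s) ^ 2 ^ Suc s" by (simp flip: power_mult)
  finally show ?case .
qed simp

text \<open>Products lead from \<open>W t\<close> to \<open>W (Suc t)\<close>, so the growth lemma
  applies \<open>s\<close> times; the dimension of \<open>W s\<close> is at most the number of
  points.\<close>

lemma card_span_ind_no_atom:
  fixes \<F> :: "'i set set"
  assumes N: "finite N" "\<F> \<subseteq> Pow N"
    and no_atom: "\<And>A. A \<noteq> {} \<Longrightarrow> A \<subseteq> N \<Longrightarrow> (\<And>B. B \<in> \<F> \<Longrightarrow> A \<subseteq> B \<or> A \<inter> B = {}) \<Longrightarrow>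
      (ind A :: 'i \<Rightarrow> 'a::{field,finite}) \<notin> fmod.span (ind ` meets (2 ^ s) \<F>)"
  shows "card (fmod.span (ind ` \<F>) :: ('i \<Rightarrow> 'a) set) ^ (3 ^ s) \<le> (CARD('a) ^ card N) ^ (2 ^ s)"
proof -
  define W :: "nat \<Rightarrow> ('i \<Rightarrow> 'a) set" where "W t = fmod.span (ind ` meets (2 ^ t) \<F>)" for t
  define col where "col x = {B \<in> \<F>. x \<in> B}" for x
  \<comment> \<open>\<open>X\<close> has one point for each nonempty collection of members
    containing a point. Functions in \<open>W t\<close> are constant on these classes and zero
    elsewhere, so \<open>X\<close> determines them, while distinct points of \<open>X\<close> are
    separated by a member.\<close>
  obtain X where X: "X \<subseteq> {x \<in> N. col x \<noteq> {}}" "inj_on col X" "col ` {x \<in> N. col x \<noteq> {}} = col ` X"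
    using subset_refl[of "col ` {x \<in> N. col x \<noteq> {}}", unfolded subset_image_inj] by (elim exE conjE)
  have finX: "finite X" using X(1) N(1) finite_subset by fastforce
  have const: "f x = f y" if "f \<in> W t" "col x = col y" for f x y t
    using that(1) unfolding W_def
    by (rule span_ind_const) (rule mem_meets_iff, assumption, use that(2) in \<open>simp add: col_def\<close>)
  have zero: "f x = 0" if "f \<in> W t" "col x = {}" for f x t
    using that(1) unfolding W_def
    by (rule span_ind_zero) (use that(2) in \<open>fastforce simp: col_def meets_def\<close>)
  have zero': "f x = 0" if "f \<in> W t" "x \<notin> N" for f x t
    using that N(2) by (intro zero) (auto simp: col_def)
  have mono: "W t \<subseteq> W u" if "t \<le> u" for t u
    unfolding W_def using that by (intro fmod.span_mono image_mono meets_mono power_increasing) auto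
  have mem_W: "ind B \<in> W t" if "B \<in> \<F>" for B t
    unfolding W_def using that by (intro fmod.span_base imageI meets_single) auto
  have subW: "fmod.subspace (W t)" for t unfolding W_def by (rule fmod.subspace_span)

  have sep: "\<exists>f\<in>W t. f x = a \<and> f y = b" if B: "B \<in> \<F>" "x \<in> B" "y \<notin> B" and C: "C \<in> \<F>" "y \<in> C"
    for t x y a b B C
  proof -
    \<comment> \<open>\<open>C\<close> sets the value at \<open>y\<close>; \<open>B\<close>, which
      misses \<open>y\<close>, then corrects the value at \<open>x\<close>.\<close>
    let ?f = "fscale b (ind C) + fscale (a - b * ind C x) (ind B)"
    have "?f \<in> W t" using subW mem_W B(1) C(1) by (intro fmod.subspace_add fmod.subspace_scale)
    moreover have "?f x = a" "?f y = b" using B C by (simp_all add: fscale_apply ind_def)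
    ultimately show ?thesis by blast
  qed
  have growth: "card (res X ` W t) ^ 3 \<le> card (res X ` W (Suc t)) ^ 2" if "t < s" for t
  proof (rule card_product_space_growth[OF finX subW subW])
    show "W t \<subseteq> W (Suc t)" by (rule mono) simp
  next
    fix f g assume "f \<in> W t" "g \<in> W t"
    then show "f * g \<in> W (Suc t)"
      using span_meets_mult[of f "2 ^ t" \<F> g "2 ^ t"] by (simp add: W_def mult_2)
  next
    fix x y a b assume xy: "x \<in> X" "y \<in> X" "x \<noteq> y"
    then have "col x \<noteq> col y" "col x \<noteq> {}" "col y \<noteq> {}" using X(1,2) by (auto dest: inj_onD)
    then show "\<exists>f\<in>W t. f x = a \<and> f y = b"
    proof -
      obtain Bx By where *: "Bx \<in> \<F>" "x \<in> Bx" "By \<in> \<F>" "y \<in> By"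
        using \<open>col x \<noteq> {}\<close> \<open>col y \<noteq> {}\<close> by (auto simp: col_def)
      obtain B where "B \<in> \<F>" "x \<in> B \<and> y \<notin> B \<or> y \<in> B \<and> x \<notin> B"
        using \<open>col x \<noteq> col y\<close> by (auto simp: col_def)
      then show ?thesis using sep[of B x y By t a b] sep[of B y x Bx t b a] * by blast
    qed
  next
    fix x u assume x: "x \<in> X" and u: "u \<in> W (Suc t)" and u0: "\<forall>y\<in>X - {x}. u y = 0"
    show "u x = 0"
    proof (rule ccontr)
      assume ux: "u x \<noteq> 0"
      \<comment> \<open>On the class \<open>A\<close> of \<open>x\<close> the function
        \<open>u\<close> is a nonzero constant and elsewhere it is zero. So the indicator of
        \<open>A\<close> is a multiple of \<open>u\<close>, against \<open>no_atom\<close>.\<close>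
      define A where "A = {y \<in> N. col y = col x}"
      have "ind A y = fscale (1 / u x) u y" for y
      proof (cases "y \<in> A")
        case True
        then show ?thesis using const[OF u, of y x] ux by (simp add: A_def ind_def fscale_apply)
      next
        case False
        have "u y = 0"
        proof (cases "y \<in> N \<and> col y \<noteq> {}")
          case True
          then have "col y \<in> col ` X" using X(3) by blast
          then obtain z where "z \<in> X" "col y = col z" by blast
          moreover from this False True have "z \<noteq> x" by (auto simp: A_def)
          ultimately show ?thesis using u0 const[OF u, of y z] by auto
        qed (use zero[OF u] zero'[OF u] in auto)
        then show ?thesis using False by (simp add: ind_def fscale_apply)
      qed
      then have "ind A = fscale (1 / u x) u" by (rule ext)
      then have "ind A \<in> W (Suc t)" using u subW by (metis fmod.subspace_scale)
      then have "ind A \<in> W s" using mono[of "Suc t" s] that by auto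
      moreover have "A \<noteq> {}" "A \<subseteq> N" using x X(1) by (auto simp: A_def)
      moreover have "A \<subseteq> B \<or> A \<inter> B = {}" if "B \<in> \<F>" for B
        using that by (auto simp: A_def col_def)
      ultimately show False using no_atom[of A] unfolding W_def by blast
    qed
  qed
  have "card (fmod.span (ind ` \<F>) :: ('i \<Rightarrow> 'a) set) \<le> card (W 0)"
  proof (rule card_mono)
    show "finite (W 0)" unfolding W_def
      by (rule finite_span_ind[OF N(1)]) (use meets_subset N(2) in blast)
    show "fmod.span (ind ` \<F>) \<subseteq> W 0"
      using mem_W subW by (intro fmod.span_minimal) auto
  qed
  also have "inj_on (res X) (W 0)"
  proof (rule inj_onI, rule ext)
    fix f g y assume f: "f \<in> W 0" and g: "g \<in> W 0" and eq: "res X f = res X g"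
    show "f y = g y"
    proof (cases "y \<in> N \<and> col y \<noteq> {}")
      case True
      then have "col y \<in> col ` X" using X(3) by blast
      then obtain z where z: "z \<in> X" "col y = col z" by blast
      have "f z = g z" using fun_cong[OF eq, of z] z by (simp add: res_apply)
      then show ?thesis using const[OF f z(2)] const[OF g z(2)] by simp
    next
      case False
      then show ?thesis using zero[OF f] zero[OF g] zero'[OF f] zero'[OF g] by (cases "y \<in> N") auto
    qed
  qed
  then have "card (W 0) = card (res X ` W 0)" by (simp add: card_image)
  finally have "card (fmod.span (ind ` \<F>) :: ('i \<Rightarrow> 'a) set) ^ 3 ^ s \<le> card (res X ` W 0) ^ 3 ^ s"
    by (rule power_mono) simp
  also have "\<dots> \<le> card (res X ` W s) ^ 2 ^ s"
    using growth by (rule power_3_2_iterate)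
  also have "\<dots> \<le> (CARD('a) ^ card N) ^ 2 ^ s"
  proof (rule power_mono)
    have "card (res X ` W s) \<le> CARD('a) ^ card X" by (rule card_res_le[OF finX])
    also have "\<dots> \<le> CARD('a) ^ card N"
      using X(1) N(1) by (intro power_increasing card_mono) auto
    finally show "card (res X ` W s) \<le> CARD('a) ^ card N" .
  qed simp
  finally show ?thesis .
qed

text \<open>The alternative between deletion and growth, by induction on the number of points. The
  exponent \<open>s\<close> makes (3/2)^s at least \<open>l\<close>, and \<open>l * 2 ^ s\<close>
  members suffice for the divisibility argument with \<open>j = 2 ^ s\<close>.\<close>

lemma card_span_closed_family:
  fixes \<F> :: "'i set set"
  assumes "finite N" "\<F> \<subseteq> Pow N" and l: "l = CARD('p::prime_card) ^ \<alpha>"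
    and s: "l * 2 ^ s \<le> 3 ^ s"
    and dvd: "\<And>B. B \<in> meets (l * 2 ^ s) \<F> \<Longrightarrow> l dvd card B"
  shows "card (fmod.span (ind ` \<F>) :: ('i \<Rightarrow> 'p mod_ring) set) ^ l \<le> CARD('p) ^ card N"
  using assms(1,2) dvd
proof (induction "card N" arbitrary: N \<F> rule: less_induct)
  case less
  let ?V = "\<lambda>\<F>. fmod.span (ind ` \<F>) :: ('i \<Rightarrow> 'p mod_ring) set"
  have "l > 0" by (simp add: l)
  show ?case
  proof (cases "\<exists>A. A \<noteq> {} \<and> A \<subseteq> N \<and> (\<forall>B\<in>\<F>. A \<subseteq> B \<or> A \<inter> B = {}) \<and> ind A \<in> ?V (meets (2 ^ s) \<F>)")
    case True
    then obtain A where A: "A \<noteq> {}" "A \<subseteq> N" and "\<forall>B\<in>\<F>. A \<subseteq> B \<or> A \<inter> B = {}"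
      and indA: "ind A \<in> ?V (meets (2 ^ s) \<F>)" by (elim exE conjE)
    then have atom: "\<And>B. B \<in> \<F> \<Longrightarrow> A \<subseteq> B \<or> A \<inter> B = {}" by (rule_tac bspec)
    from A indA have lA: "l dvd card A"
      using less.prems l by (intro dvd_card_of_ind_in_span[of N \<F> A l \<alpha> "2 ^ s"]) auto
    have finA: "finite A" using A(2) less.prems(1) finite_subset by blast
    have "card A > 0" using A(1) finA by auto
    then have "l \<le> card A" using lA by (auto dest: dvd_imp_le)
    have cN: "card (N - A) = card N - card A" "card A \<le> card N"
      using A(2) finA less.prems(1) by (auto simp: card_Diff_subset card_mono)
    have IH: "card (?V ((\<lambda>B. B - A) ` \<F>)) ^ l \<le> CARD('p) ^ card (N - A)"
    proof (rule less.hyps)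
      show "card (N - A) < card N" using cN \<open>card A > 0\<close> by simp
      show "finite (N - A)" "(\<lambda>B. B - A) ` \<F> \<subseteq> Pow (N - A)" using less.prems by auto
      fix B assume "B \<in> meets (l * 2 ^ s) ((\<lambda>B. B - A) ` \<F>)"
      then obtain C where C: "C \<in> meets (l * 2 ^ s) \<F>" "B = C - A" by (rule meets_Diff)
      \<comment> \<open>An intersection loses all of \<open>A\<close> or nothing, and
        \<open>l\<close> divides \<open>card A\<close>; so the divisibility survives the
        deletion.\<close>
      then have "A \<subseteq> C \<or> A \<inter> C = {}" using atom by (fastforce simp: meets_def)
      then show "l dvd card B"
      proof
        assume "A \<subseteq> C"
        then show ?thesis using less.prems(3)[OF C(1)] lA C(2) finA by (simp add: card_Diff_subset)
      next
        assume "A \<inter> C = {}"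
        then have "B = C" using C(2) by auto
        then show ?thesis using less.prems(3)[OF C(1)] by simp
      qed
    qed
    have "card (?V \<F>) ^ l \<le> (card (?V ((\<lambda>B. B - A) ` \<F>)) * CARD('p)) ^ l"
      using card_span_ind_remove[OF less.prems(1,2) A(2,1) atom, where 'a = "'p mod_ring"]
      by (intro power_mono) auto
    \<comment> \<open>The lost dimension costs a factor \<open>CARD('p) ^ l\<close>, which the at
      least \<open>l\<close> deleted points pay for.\<close>
    also have "\<dots> \<le> CARD('p) ^ card (N - A) * CARD('p) ^ card A"
      unfolding power_mult_distrib using IH \<open>l \<le> card A\<close>
      by (intro mult_le_mono power_increasing) auto
    also have "\<dots> = CARD('p) ^ card N" using cN by (simp flip: power_add)
    finally show ?thesis .
  next
    case False
    let ?D = "card (?V \<F>)"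
    have "?D > 0"
      using finite_span_ind[OF less.prems(1,2), where 'a = "'p mod_ring"] fmod.span_zero
      by (auto simp: card_gt_0_iff)
    then have "(?D ^ l) ^ 2 ^ s \<le> ?D ^ 3 ^ s"
      using s by (simp flip: power_mult add: power_increasing)
    also have "\<dots> \<le> (CARD('p mod_ring) ^ card N) ^ 2 ^ s"
    proof (rule card_span_ind_no_atom[OF less.prems(1,2)])
      fix A assume "A \<noteq> {}" "A \<subseteq> N" and "\<And>B. B \<in> \<F> \<Longrightarrow> A \<subseteq> B \<or> A \<inter> B = {}"
      then show "ind A \<notin> ?V (meets (2 ^ s) \<F>)"
        using False by (metis (no_types, lifting))
    qed
    finally have "(?D ^ l) ^ 2 ^ s \<le> (CARD('p) ^ card N) ^ 2 ^ s" by simp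
    then show ?thesis by (simp add: power_mono_iff)
  qed
qed

section \<open>From vectors to set families\<close>

definition supp :: "nat vec \<Rightarrow> nat set" where
  "supp v = {j. j < dim_vec v \<and> v $ j = 1}"

lemma zero_one_vecsD:
  assumes "v \<in> zero_one_vecs n"
  shows "dim_vec v = n" "j < n \<Longrightarrow> v $ j = of_bool (j \<in> supp v)"
  using assms by (auto simp: zero_one_vecs_def supp_def)

text \<open>A coordinatewise product of 0-1 vectors is the indicator vector of the intersection of
  their supports, so its norm counts that intersection.\<close>

lemma k_closed_meets:
  assumes F: "F \<subseteq> zero_one_vecs n" and closed: "k_closed k l n F"
    and B: "B \<in> meets k (supp ` F)"
  shows "l dvd card B"
proof -
  obtain \<G> where \<G>: "B = \<Inter>\<G>" "\<G> \<subseteq> supp ` F" "\<G> \<noteq> {}" "finite \<G>" "card \<G> \<le> k"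
    using B by (auto simp: meets_def)
  \<comment> \<open>One vector per support keeps the number of factors at most \<open>k\<close>;
    nonemptiness of \<open>\<G>\<close> makes it at least 1.\<close>
  from \<G>(2) obtain H where H: "H \<subseteq> F" "inj_on supp H" "\<G> = supp ` H"
    by (auto simp: subset_image_inj)
  have finH: "finite H" using H \<G>(4) by (simp add: finite_image_iff)
  have "card H = card \<G>" using H by (simp add: card_image)
  then have cH: "card H \<in> {1..k}"
    using \<G>(3-5) H finH by (auto simp: Suc_le_eq card_gt_0_iff)
  obtain h where h: "bij_betw h {1..card H} H"
    using ex_bij_betw_nat_finite_1[OF finH] by blast
  define v where "v = vec n (\<lambda>j. \<Prod>m=1..card H. h m $ j)"
  have "v \<in> product_family n F (card H)"
    unfolding product_family_def v_def using h H(1) by (auto dest: bij_betwE)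
  then have "norm_mod l v = 0" using closed cH unfolding k_closed_def by blast
  then have "l dvd (\<Sum>j<n. v $ j)" by (auto simp: norm_mod_def v_def)
  moreover have "v $ j = of_bool (j \<in> B)" if "j < n" for j
  proof -
    have "v $ j = (\<Prod>u\<in>H. u $ j)"
      using that prod.reindex_bij_betw[OF h, of "\<lambda>u. u $ j"] by (simp add: v_def)
    also have "\<dots> = (\<Prod>u\<in>H. of_bool (j \<in> supp u))"
      using zero_one_vecsD(2)[OF _ that] F H(1) by (intro prod.cong) auto
    also have "\<dots> = of_bool (j \<in> B)"
      using finH H(3) \<G>(1) by (auto simp: of_bool_def prod_zero_iff)
    finally show ?thesis .
  qed
  then have "(\<Sum>j<n. v $ j) = (\<Sum>j<n. of_bool (j \<in> B))" by simp
  moreover have "B \<subseteq> {..<n}"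
    using \<G>(1,3) H F zero_one_vecsD(1) by (fastforce simp: supp_def)
  then have "(\<Sum>j<n. of_bool (j \<in> B)) = card B"
    by (simp add: of_bool_def sum.If_cases Int_absorb1)
  ultimately show ?thesis by simp
qed

text \<open>Different coefficient families on an independent set give different linear combinations.
  This passes from the dimension of a space of vectors to the cardinality of a space of
  functions.\<close>

lemma card_le_card_span:
  fixes U :: "'p::prime_card mod_ring vec set"
  assumes "finite U" and U: "U \<subseteq> regard_mod ` F" and F: "F \<subseteq> zero_one_vecs n"
    and li: "\<not> module.lin_dep class_ring (module_vec TYPE('p mod_ring) n) U"
  shows "CARD('p) ^ card U \<le> card (fmod.span (ind ` supp ` F) :: (nat \<Rightarrow> 'p mod_ring) set)"
proof -
  interpret vec_space "TYPE('p mod_ring)" n .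
  let ?V = "fmod.span (ind ` supp ` F) :: (nat \<Rightarrow> 'p mod_ring) set"
  \<comment> \<open>A vector becomes a function on all naturals, zero from \<open>n\<close> on, to
    agree with the indicator of its support.\<close>
  define e :: "'p mod_ring vec \<Rightarrow> nat \<Rightarrow> 'p mod_ring" where "e u x = (if x < n then u $ x else 0)" for u x
  define \<Phi> where "\<Phi> a = (\<Sum>u\<in>U. fscale (a u) (e u))" for a
  have Uc: "U \<subseteq> carrier_vec n" using U F by (fastforce simp: zero_one_vecs_def regard_mod_def)
  have e_mem: "e u \<in> ?V" if "u \<in> U" for u
  proof -
    obtain v where v: "v \<in> F" "u = regard_mod v" using U \<open>u \<in> U\<close> by auto
    have v01: "v \<in> zero_one_vecs n" using v(1) F by auto
    have "e u x = ind (supp v) x" for x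
      using zero_one_vecsD(1)[OF v01] zero_one_vecsD(2)[OF v01, of x]
      by (cases "x < n") (auto simp: e_def v(2) regard_mod_def ind_def supp_def)
    then have "e u = ind (supp v)" by (rule ext)
    then show ?thesis using v(1) by (auto intro: fmod.span_base)
  qed
  have "inj_on \<Phi> (U \<rightarrow>\<^sub>E UNIV)"
  proof (rule inj_onI)
    fix a b assume ab: "a \<in> U \<rightarrow>\<^sub>E UNIV" "b \<in> U \<rightarrow>\<^sub>E UNIV" "\<Phi> a = \<Phi> b"
    define c where "c u = a u - b u" for u
    have "lincomb c U = 0\<^sub>v n"
    proof (rule eq_vecI)
      fix i assume "i < dim_vec (0\<^sub>v n)"
      then have i: "i < n" by simp
      have "lincomb c U $ i = \<Phi> a i - \<Phi> b i"
        using lincomb_index[OF i Uc, of c] i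
        by (simp add: \<Phi>_def sum_fun_apply fscale_apply e_def c_def algebra_simps sum_subtractf)
      then show "lincomb c U $ i = 0\<^sub>v n $ i" using ab(3) i by simp
    qed (use lincomb_dim[OF \<open>finite U\<close> Uc] in simp)
    then have "c u = 0" if "u \<in> U" for u
      using not_lindepD[OF li \<open>finite U\<close> subset_refl, of c] that by (auto simp: class_ring_simps)
    then have "a u = b u" if "u \<in> U" for u using that by (simp add: c_def)
    then show "a = b" using ab(1,2) by (intro PiE_ext)
  qed
  moreover have "\<Phi> ` (U \<rightarrow>\<^sub>E UNIV) \<subseteq> ?V"
    by (auto simp: \<Phi>_def intro!: fmod.span_sum fmod.span_scale e_mem)
  moreover have "finite ?V"
    by (rule finite_span_ind[of "{..<n}"]) (use F zero_one_vecsD(1) in \<open>auto simp: supp_def\<close>)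
  ultimately have "card (U \<rightarrow>\<^sub>E (UNIV :: 'p mod_ring set)) \<le> card ?V"
    by (metis card_inj_on_le)
  then show ?thesis using \<open>finite U\<close> by (simp add: card_PiE)
qed

text \<open>The witness is \<open>l * 2 ^ s\<close> with \<open>s = 2 * l\<close>, which depends on
  \<open>l\<close> only; this \<open>s\<close> works because l 4^l \<le> 8^l \<le> 9^l.\<close>

theorem theorem3p10:
  fixes p \<alpha> l :: nat
  assumes "prime p" and "CARD('p::prime_card) = p"
    and "\<alpha> > 0" and "l = p ^ \<alpha>"
  shows "\<exists>k>0. \<forall>n. \<forall>F \<subseteq> zero_one_vecs n. k_closed k l n F \<longrightarrow>
    vec_space.span_dim n ((regard_mod :: nat vec \<Rightarrow> 'p mod_ring vec) ` F) \<le> n div l"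
proof (intro exI[of _ "l * 2 ^ (2 * l)"] conjI allI impI)
  have "l > 0" using assms by (simp add: prime_gt_0_nat)
  then show "l * 2 ^ (2 * l) > 0" by simp
  fix n and F assume F: "F \<subseteq> zero_one_vecs n" and closed: "k_closed (l * 2 ^ (2 * l)) l n F"
  interpret vec_space "TYPE('p mod_ring)" n .
  let ?R = "(regard_mod :: nat vec \<Rightarrow> 'p mod_ring vec) ` F"
  have "inj_on supp (zero_one_vecs n)"
  proof (rule inj_onI)
    fix v w assume vw: "v \<in> zero_one_vecs n" "w \<in> zero_one_vecs n" "supp v = supp w"
    then show "v = w" by (intro eq_vecI) (auto simp: zero_one_vecsD)
  qed
  moreover have "supp ` zero_one_vecs n \<subseteq> Pow {..<n}" using zero_one_vecsD(1) by (auto simp: supp_def)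
  ultimately have "finite (zero_one_vecs n)" by (rule inj_on_finite) simp
  then have finR: "finite ?R" using F finite_subset by blast
  have R: "?R \<subseteq> carrier_vec n" using F by (auto simp: zero_one_vecs_def regard_mod_def)
  have "lin_indpt {}" by (rule finite_lin_indpt2) auto
  \<comment> \<open>The dimension of the span is the size of a maximal independent subset of the
    generators.\<close>
  then obtain U where U: "finite U" "maximal U (\<lambda>T. T \<subseteq> ?R \<and> lin_indpt T)"
    using maximal_exists_superset[OF finR, of "\<lambda>T. T \<subseteq> ?R \<and> lin_indpt T" "{}"] by auto
  then have "U \<subseteq> ?R" "lin_indpt U" by (auto simp: maximal_def)
  have dim: "span_dim ?R = card U"
    unfolding span_dim_def using R finR U(2) by (intro dim_span) auto
  \<comment> \<open>The bound on cardinalities turns back into one on dimensions by comparing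
    exponents of \<open>CARD('p)\<close>.\<close>
  have "CARD('p) ^ (card U * l) = (CARD('p) ^ card U) ^ l" by (simp add: power_mult)
  also have "\<dots> \<le> card (fmod.span (ind ` supp ` F) :: (nat \<Rightarrow> 'p mod_ring) set) ^ l"
    using card_le_card_span[OF U(1) \<open>U \<subseteq> ?R\<close> F \<open>lin_indpt U\<close>] by (rule power_mono) simp
  also have "\<dots> \<le> CARD('p) ^ card {..<n}"
  proof (rule card_span_closed_family)
    show "l = CARD('p) ^ \<alpha>" using assms by simp
    have "l * 2 ^ (2 * l) \<le> 2 ^ l * 4 ^ l" by (simp add: power_mult less_imp_le)
    also have "\<dots> = 8 ^ l" by (simp flip: power_mult_distrib)
    also have "\<dots> \<le> 9 ^ l" by (rule power_mono) auto
    finally show "l * 2 ^ (2 * l) \<le> 3 ^ (2 * l)" by (simp add: power_mult)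
    show "supp ` F \<subseteq> Pow {..<n}" using F zero_one_vecsD(1) by (auto simp: supp_def)
    fix B assume "B \<in> meets (l * 2 ^ (2 * l)) (supp ` F)"
    then show "l dvd card B" by (rule k_closed_meets[OF F closed])
  qed simp
  finally have "CARD('p) ^ (card U * l) \<le> CARD('p) ^ n" by simp
  then have "card U * l \<le> n"
    using prime_gt_1_nat[OF assms(1)] assms(2) by (simp add: power_increasing_iff)
  then show "span_dim ?R \<le> n div l"
    using \<open>l > 0\<close> by (simp add: dim less_eq_div_iff_mult_less_eq)
qed

end
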